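(* There exists a convex-polyhedral surface $\mathcal{S}$ in $\mathbb{R}^3$ whose adjacency graph $\mathcal{G}(\mathcal{S})$ is isomorphic to the complete bipartite graph $K_{4,4}$.
   Context: A polygon in $\mathbb{R}^3$ is a closed planar region (including its interior) bounded by a simple closed polygonal chain lying in some plane of $\mathbb{R}^3$; its vertices are called corners and its edges are called sides. A polyhedral surface $\mathcal{S}=\{S_1,\dots,S_n\}$ is a set of $n$ closed polygons embedded in $\mathbb{R}^3$ such that, for all pairwise distinct indices $i,j,k$: (1) $S_i$ and $S_j$ are interior-disjoint (with respect to the 2D relative interiors); (2) if $S_i\cap S_j\neq\emptyset$, then $S_i\cap S_j$ is either a single corner or a complete side of both $S_i$ and $S_j$; (3) if $S_i\cap S_j\cap S_k\neq\emptyset$, then it is a single corner (so a side is shared by at most two polygons). Sides need not be shared with another polygon. The adjacency graph $\mathcal{G}(\mathcal{S})$ has one vertex for each polygon of $\mathcal{S}$ and an edge between two vertices if and only if the corresponding polygons share a side (contacts in a single corner do not give an edge). A convex-polyhedral surface is a polyhedral surface all of whose polygons are strictly convex. *)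

theory Defs
  imports "HOL-Analysis.Analysis" "Graph_Theory.Graph_Theory"
begin

text \<open>
  A polygon is given by the cyclic list of its corners. A corner with a straight angle is
  allowed for a general polygon, so the corners cannot be recovered from the region alone.
\<close>

type_synonym polygon = "(real^3) list"

definition side_ends :: "polygon \<Rightarrow> nat \<Rightarrow> (real^3) set" where
  "side_ends p i = {p ! i, p ! (Suc i mod length p)}"

definition side :: "polygon \<Rightarrow> nat \<Rightarrow> (real^3) set" where
  "side p i = closed_segment (p ! i) (p ! (Suc i mod length p))"

definition sides :: "polygon \<Rightarrow> (real^3) set set" where
  "sides p = side p ` {..<length p}"

definition corners :: "polygon \<Rightarrow> (real^3) set" where
  "corners p = set p"

text \<open>
  The last condition says that the closed chain is simple: sides that are consecutive meet
  exactly in their common corner, and all other sides are disjoint.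
\<close>

definition polygon :: "polygon \<Rightarrow> bool" where
  "polygon p \<longleftrightarrow>
     3 \<le> length p \<and> distinct p \<and> aff_dim (set p) = 2 \<and>
     (\<forall>i<length p. \<forall>j<length p. i \<noteq> j \<longrightarrow>
        side p i \<inter> side p j = side_ends p i \<inter> side_ends p j)"

definition chain_of :: "polygon \<Rightarrow> (real^3) set" where
  "chain_of p = \<Union> (sides p)"

text \<open>
  The closed region bounded by the chain: the chain together with the bounded component of its
  complement in the plane of the polygon. The library constant \<open>inside\<close> takes the complement in
  the whole space, where a closed chain in \<open>real^3\<close> encloses nothing, so the analogous formula is
  used relative to the plane.
\<close>

definition region :: "polygon \<Rightarrow> (real^3) set" where
  "region p = chain_of p \<union>
     {x \<in> affine hull (set p) - chain_of p.
        bounded (connected_component_set (affine hull (set p) - chain_of p) x)}"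

text \<open>Strictly convex: the region is convex and no corner has a straight angle.\<close>

definition strictly_convex_polygon :: "polygon \<Rightarrow> bool" where
  "strictly_convex_polygon p \<longleftrightarrow>
     polygon p \<and> convex (region p) \<and>
     (\<forall>i<length p.
        \<not> collinear {p ! i, p ! (Suc i mod length p), p ! (Suc (Suc i) mod length p)})"

text \<open>
  Different lists that describe the same polygon (rotations, reversals) cannot both belong to a
  surface, since their interiors would intersect.
\<close>

definition polyhedral_surface :: "polygon set \<Rightarrow> bool" where
  "polyhedral_surface S \<longleftrightarrow>
     finite S \<and> (\<forall>p\<in>S. polygon p) \<and>
     (\<forall>p\<in>S. \<forall>q\<in>S. p \<noteq> q \<longrightarrow>
        rel_interior (region p) \<inter> rel_interior (region q) = {}) \<and>
     (\<forall>p\<in>S. \<forall>q\<in>S. p \<noteq> q \<longrightarrow> region p \<inter> region q \<noteq> {} \<longrightarrow>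
        (\<exists>v \<in> corners p \<inter> corners q. region p \<inter> region q = {v}) \<or>
        region p \<inter> region q \<in> sides p \<inter> sides q) \<and>
     (\<forall>p\<in>S. \<forall>q\<in>S. \<forall>r\<in>S. p \<noteq> q \<longrightarrow> p \<noteq> r \<longrightarrow> q \<noteq> r \<longrightarrow>
        region p \<inter> region q \<inter> region r \<noteq> {} \<longrightarrow>
        (\<exists>v \<in> corners p \<inter> corners q \<inter> corners r. region p \<inter> region q \<inter> region r = {v}))"

definition convex_polyhedral_surface :: "polygon set \<Rightarrow> bool" where
  "convex_polyhedral_surface S \<longleftrightarrow>
     polyhedral_surface S \<and> (\<forall>p\<in>S. strictly_convex_polygon p)"

text \<open>As usual for \<open>Graph_Theory\<close>, an undirected graph is a symmetric digraph.\<close>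

definition adjacency_graph :: "polygon set \<Rightarrow> polygon pair_pre_digraph" where
  "adjacency_graph S =
     \<lparr> pverts = S,
       parcs = {(p, q). p \<in> S \<and> q \<in> S \<and> p \<noteq> q \<and> sides p \<inter> sides q \<noteq> {}} \<rparr>"

end

theory Submission
  imports Defs
begin

text \<open>
  Take four walls, in the vertical planes \<open>x = 13\<close>, \<open>y = 13\<close>, \<open>x + y = -7\<close>, \<open>x - y = 14\<close>, and four
  floors, in the planes \<open>z = 18\<close>, \<open>z = -5x + 2y + 26\<close>, \<open>z = -18\<close>, \<open>z = 2x + 3y - 12\<close>. On each of
  the 16 lines in which a floor plane meets a wall plane choose a short segment such that the four
  segments on each plane are the alternate sides of a strictly convex octagon. A floor and a wall
  then meet exactly in their common segment, since a convex polygon meets the line of one of its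
  sides in that side only. The segments can be chosen such that the floors are pairwise strictly
  separated by planes, and so are the walls. Hence all contacts are those of \<open>K\<^bsub>4,4\<^esub>\<close>.

  Convexity of an explicit list of corners is certified by the signs of triple products. The link
  to the topological definition of a region is that the chain of such a polygon is the relative
  frontier of the convex hull of its corners.
\<close>

section \<open>Convex polygons in space\<close>

lemma cross_orthogonal_parallel:
  assumes "n \<bullet> x = 0" and "n \<bullet> y = 0"
  shows "cross3 n (cross3 x y) = 0"
  by (simp add: Lagrange assms)

text \<open>Expanding the triple product \<open>cross3 w (cross3 u w)\<close> shows that a vector
  \<open>u\<close> parallel to \<open>w\<close> becomes a multiple of \<open>w\<close> after scaling
  by \<open>w \<bullet> w\<close>; this applies to \<open>n\<close> and to \<open>m\<close>.\<close>

lemma cross_parallel_trans: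
  assumes "cross3 n w = 0" and "cross3 m w = 0" and "w \<noteq> 0"
  shows "cross3 n m = 0"
proof -
  have *: "(w \<bullet> w) *\<^sub>R u = (w \<bullet> u) *\<^sub>R w" if "cross3 u w = 0" for u
    using Lagrange [of w u w] that by simp
  have "(w \<bullet> w) *\<^sub>R (w \<bullet> w) *\<^sub>R cross3 n m = cross3 ((w \<bullet> w) *\<^sub>R n) ((w \<bullet> w) *\<^sub>R m)"
    by (simp add: cross_mult_left cross_mult_right)
  also have "\<dots> = 0"
    by (simp add: * assms cross_mult_left cross_mult_right)
  finally show ?thesis
    using \<open>w \<noteq> 0\<close> by simp
qed

text \<open>Cramer's rule for the triple \<open>n\<close>, \<open>e\<close>, \<open>g\<close> has
  one further term, \<open>(cross3 e g \<bullet> z) *\<^sub>R n\<close>. It vanishes: if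
  \<open>n\<close> is nonzero, then \<open>cross3 e g\<close> is parallel to \<open>n\<close> and
  hence orthogonal to \<open>z\<close>.\<close>

lemma planar_decomposition:
  fixes n e g z :: "real^3"
  assumes "n \<bullet> e = 0" "n \<bullet> g = 0" "n \<bullet> z = 0"
  shows "(n \<bullet> cross3 e g) *\<^sub>R z = (n \<bullet> cross3 z g) *\<^sub>R e + (n \<bullet> cross3 e z) *\<^sub>R g"
proof -
  have "(n \<bullet> n) * (cross3 e g \<bullet> z) = 0"
    using dot_cross [of n "cross3 e g" n z] cross_orthogonal_parallel [OF assms(1,2)] assms
    by simp
  then have triple: "n = 0 \<or> cross3 e g \<bullet> z = 0" by simp
  have "(n \<bullet> cross3 e g) *\<^sub>R z =
      (n \<bullet> cross3 z g) *\<^sub>R e + (n \<bullet> cross3 e z) *\<^sub>R g + (cross3 e g \<bullet> z) *\<^sub>R n"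
    by (simp add: vec_eq_iff forall_3 cross3_def inner_vec_def sum_3) (algebra)
  with triple show ?thesis by auto
qed

section \<open>Convex hulls, and components of the complement of a relative frontier\<close>

text \<open>The left side is a face, and a face of the hull of a finite set is the hull of some of
  the generators.\<close>

lemma convex_hull_Int_supporting_hyperplane:
  fixes S :: "'a::euclidean_space set"
  assumes "finite S" and "\<And>x. x \<in> S \<Longrightarrow> b \<le> a \<bullet> x"
  shows "convex hull S \<inter> {x. a \<bullet> x = b} = convex hull (S \<inter> {x. a \<bullet> x = b})"
proof
  have "convex hull S \<subseteq> {x. b \<le> a \<bullet> x}"
    by (rule hull_minimal) (use assms in \<open>auto simp: convex_halfspace_ge\<close>)
  then have "convex hull S \<inter> {x. a \<bullet> x = b} face_of convex hull S"
    by (intro face_of_Int_supporting_hyperplane_ge) auto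
  then obtain S' where S': "S' \<subseteq> S" "convex hull S \<inter> {x. a \<bullet> x = b} = convex hull S'"
    using face_of_convex_hull_subset \<open>finite S\<close> finite_imp_compact by metis
  then have "S' \<subseteq> S \<inter> {x. a \<bullet> x = b}"
    using hull_subset [of S' convex] by blast
  with S' show "convex hull S \<inter> {x. a \<bullet> x = b} \<subseteq> convex hull (S \<inter> {x. a \<bullet> x = b})"
    by (simp add: hull_mono)
  show "convex hull (S \<inter> {x. a \<bullet> x = b}) \<subseteq> convex hull S \<inter> {x. a \<bullet> x = b}"
    by (rule hull_minimal)
       (auto simp: convex_Int convex_hyperplane hull_inc)
qed

lemma disjoint_convex_hulls:
  fixes S T :: "'a::euclidean_space set"
  assumes "\<And>x. x \<in> S \<Longrightarrow> a \<bullet> x < b" and "\<And>x. x \<in> T \<Longrightarrow> b < a \<bullet> x"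
  shows "convex hull S \<inter> convex hull T = {}"
proof -
  have "convex hull S \<subseteq> {x. a \<bullet> x < b}" "convex hull T \<subseteq> {x. b < a \<bullet> x}"
    by (rule hull_minimal; use assms in \<open>auto simp: convex_halfspace_lt convex_halfspace_gt\<close>)+
  then show ?thesis by fastforce
qed

text \<open>Off the relative frontier, the relative interior and the complement of \<open>S\<close>
  are separated by open sets, so the component of an interior point stays in \<open>S\<close>. From
  a point outside \<open>S\<close>, the ray pointing away from some \<open>z\<close> in
  \<open>S\<close> never meets \<open>S\<close> and is unbounded.\<close>

lemma bounded_component_iff_rel_interior:
  fixes S :: "'a::euclidean_space set"
  assumes "convex S" "compact S" and x: "x \<in> affine hull S - rel_frontier S"
  shows "bounded (connected_component_set (affine hull S - rel_frontier S) x) \<longleftrightarrow> x \<in> rel_interior S"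
    (is "bounded ?C \<longleftrightarrow> _")
proof
  assume xS: "x \<in> rel_interior S"
  have "closed S" using \<open>compact S\<close> compact_imp_closed by blast
  then have rf: "rel_frontier S = S - rel_interior S"
    by (simp add: rel_frontier_def)
  obtain U where U: "open U" "rel_interior S = affine hull S \<inter> U"
    using openin_rel_interior [of S] by (auto simp: openin_open)
  have C: "?C \<subseteq> affine hull S - rel_frontier S"
    by (rule connected_component_subset)
  have "U \<inter> ?C = {} \<or> - S \<inter> ?C = {}"
  proof (rule connectedD [OF connected_connected_component \<open>open U\<close>])
    show "open (- S)" using \<open>closed S\<close> by blast
    show "U \<inter> - S \<inter> ?C = {}"
      using C U rel_interior_subset [of S] by blast
    show "?C \<subseteq> U \<union> - S"
      using C U rf by blast
  qed
  moreover have "x \<in> U \<inter> ?C"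
    using x xS U by (simp add: connected_component_refl)
  ultimately have "?C \<subseteq> S" by blast
  then show "bounded ?C"
    using \<open>compact S\<close> bounded_subset compact_imp_bounded by blast
next
  assume bd: "bounded ?C"
  show "x \<in> rel_interior S"
  proof (rule ccontr)
    assume "x \<notin> rel_interior S"
    with x have "x \<notin> S"
      using closure_subset [of S] by (auto simp: rel_frontier_def)
    have "S \<noteq> {}" using x by auto
    then obtain z where z: "z \<in> S" by auto
    define ray where "ray = (\<lambda>t. x + t *\<^sub>R (x - z)) ` {0..}"
    have notin: "x + t *\<^sub>R (x - z) \<notin> S" if "t \<ge> 0" for t
    proof
      assume y: "x + t *\<^sub>R (x - z) \<in> S"
      \<comment> \<open>A point of \<open>S\<close> on the ray would put \<open>x\<close> on a
        segment from it to \<open>z\<close>, hence into \<open>S\<close>.\<close>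
      have "x = (t / (1 + t)) *\<^sub>R z + (1 / (1 + t)) *\<^sub>R (x + t *\<^sub>R (x - z))"
        using that by (simp add: field_simps flip: scaleR_add_left)
      also have "\<dots> \<in> S"
        using \<open>convex S\<close> z y that by (intro convexD) (auto simp: divide_simps)
      finally show False using \<open>x \<notin> S\<close> by blast
    qed
    have "ray \<subseteq> affine hull S"
    proof
      fix y assume "y \<in> ray"
      then obtain t where y: "y = x + t *\<^sub>R (x - z)" by (auto simp: ray_def)
      have "(1 + t) *\<^sub>R x + (- t) *\<^sub>R z \<in> affine hull S"
        using x z by (intro mem_affine [OF affine_affine_hull]) (auto simp: hull_inc)
      then show "y \<in> affine hull S" by (simp add: y algebra_simps)
    qed
    moreover have "ray \<inter> S = {}"
      using notin by (auto simp: ray_def)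
    moreover have "rel_frontier S \<subseteq> S"
      using \<open>compact S\<close> by (simp add: rel_frontier_def compact_imp_closed Diff_subset)
    ultimately have "ray \<subseteq> affine hull S - rel_frontier S" by blast
    moreover have "Topological_Spaces.connected ray" unfolding ray_def
      by (intro connected_continuous_image continuous_intros) auto
    moreover have "x \<in> ray" unfolding ray_def
      by (rule image_eqI [of _ _ 0]) auto
    ultimately have "ray \<subseteq> ?C"
      by (simp add: connected_component_maximal)
    with bd have "bounded ray" using bounded_subset by blast
    then obtain B where B: "\<And>y. y \<in> ray \<Longrightarrow> norm y \<le> B"
      by (auto simp: bounded_iff)
    have d: "norm (x - z) > 0" using z \<open>x \<notin> S\<close> by auto
    \<comment> \<open>Far enough along the ray for the triangle inequality to contradict the bound
      \<open>B\<close>.\<close>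
    define t where "t = (\<bar>B\<bar> + norm x + 1) / norm (x - z)"
    have "t \<ge> 0" by (simp add: t_def)
    have "\<bar>B\<bar> + norm x + 1 = norm (t *\<^sub>R (x - z))"
      using d by (simp add: t_def)
    also have "\<dots> \<le> norm (x + t *\<^sub>R (x - z)) + norm x"
      by (metis add.commute norm_triangle_sub add_diff_cancel_left' norm_triangle_ineq4)
    also have "\<dots> \<le> B + norm x"
      using B \<open>t \<ge> 0\<close> by (auto simp: ray_def)
    finally show False by linarith
  qed
qed

section \<open>Convex polygons certified by signs of triple products\<close>

text \<open>Seen along \<open>n\<close>, every other corner lies strictly to the left of each
  directed side. A left turn at each corner would be too weak: a pentagram turns left everywhere.
  The normal \<open>n\<close> may have any positive length.\<close>

locale ccw_polygon =
  fixes n :: "real^3" and p :: polygon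
  assumes length_ge_3: "3 \<le> length p"
    and planar: "\<And>k. k < length p \<Longrightarrow> n \<bullet> p ! k = n \<bullet> p ! 0"
    and ccw: "\<And>i k. \<lbrakk>i < length p; k < length p; k \<noteq> i; k \<noteq> Suc i mod length p\<rbrakk> \<Longrightarrow>
      0 < n \<bullet> cross3 (p ! (Suc i mod length p) - p ! i) (p ! k - p ! i)"
begin

abbreviation nxt :: "nat \<Rightarrow> nat" where
  "nxt i \<equiv> Suc i mod length p"

definition edge_dir :: "nat \<Rightarrow> real^3" where
  "edge_dir i = p ! nxt i - p ! i"

definition inward :: "nat \<Rightarrow> real^3" where
  "inward i = cross3 n (edge_dir i)"

text \<open>Read as a linear functional of \<open>x\<close>, the triple product turns
  \<open>ccw\<close> into a supporting line: among the corners, \<open>inward i\<close> is minimal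
  exactly at the two ends of side \<open>i\<close>.\<close>

lemma inward_diff: "inward i \<bullet> x - inward i \<bullet> p ! i = n \<bullet> cross3 (edge_dir i) (x - p ! i)"
proof -
  have "inward i \<bullet> (x - p ! i) = n \<bullet> cross3 (edge_dir i) (x - p ! i)"
    unfolding inward_def by (metis cross_triple inner_commute)
  then show ?thesis by (simp add: inner_diff_right)
qed

lemma nonempty: "p \<noteq> []"
  using length_ge_3 by auto

lemma nxt_less: "nxt i < length p"
  using length_ge_3 by (intro mod_less_divisor) linarith

lemma nxt_eq: "i < length p \<Longrightarrow> nxt i = (if Suc i = length p then 0 else Suc i)"
  by auto

lemma nxt_neq: "i < length p \<Longrightarrow> nxt i \<noteq> i"
  using length_ge_3 by (auto simp: nxt_eq)

lemma nxt_nxt_neq: "i < length p \<Longrightarrow> nxt (nxt i) \<noteq> i"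
  using length_ge_3 by (simp add: nxt_eq split: if_splits)

lemma nxt_surj:
  assumes "j < length p" obtains i where "i < length p" "nxt i = j"
proof (cases j)
  case 0
  with that [of "length p - 1"] nonempty show ?thesis by simp
next
  case (Suc k)
  with that [of k] assms show ?thesis by simp
qed

lemma nxt_inject: "\<lbrakk>i < length p; j < length p; nxt i = nxt j\<rbrakk> \<Longrightarrow> i = j"
  by (auto simp: nxt_eq split: if_splits)

lemma distinct: "distinct p"
proof -
  have *: "p ! i \<noteq> p ! k" if "i < length p" "k < length p" "k \<noteq> i" "k \<noteq> nxt i" for i k
    using ccw [OF that] by auto
  have "p ! i \<noteq> p ! k" if "i < length p" "k < length p" "k \<noteq> i" for i k
  proof (cases "k = nxt i")
    case True
    \<comment> \<open>The roles are exchanged: with at least three corners, \<open>i\<close> is not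
      the successor of \<open>k\<close>.\<close>
    then show ?thesis
      using * [of k i] that nxt_nxt_neq by metis
  qed (use * that in blast)
  then show ?thesis by (auto simp: distinct_conv_nth)
qed

lemma corner_in_hull: "i < length p \<Longrightarrow> p ! i \<in> convex hull set p"
  by (simp add: hull_inc)

lemma planar_convex_hull: "x \<in> convex hull set p \<Longrightarrow> n \<bullet> x = n \<bullet> p ! 0"
proof -
  have "convex hull set p \<subseteq> {x. n \<bullet> x = n \<bullet> p ! 0}"
    by (rule hull_minimal) (auto simp: in_set_conv_nth planar convex_hyperplane)
  then show "x \<in> convex hull set p \<Longrightarrow> n \<bullet> x = n \<bullet> p ! 0" by blast
qed

lemma edge_dir_orthogonal: "i < length p \<Longrightarrow> n \<bullet> edge_dir i = 0"
  using planar [of i] planar [OF nxt_less [of i]] by (simp add: edge_dir_def inner_diff_right)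

lemma inward_ends: "inward i \<bullet> p ! nxt i = inward i \<bullet> p ! i"
  using inward_diff [of i "p ! nxt i"] by (simp flip: edge_dir_def)

lemma inward_pos:
  assumes "i < length p" "k < length p" "k \<noteq> i" "k \<noteq> nxt i"
  shows "inward i \<bullet> p ! i < inward i \<bullet> p ! k"
  using ccw [OF assms] inward_diff [of i "p ! k"] by (simp add: edge_dir_def)

lemma inward_nonneg:
  assumes "i < length p" "k < length p"
  shows "inward i \<bullet> p ! i \<le> inward i \<bullet> p ! k"
  using inward_pos [OF assms] inward_ends [of i] by (cases "k = i \<or> k = nxt i") auto

lemma inward_eq_iff:
  assumes "i < length p" "k < length p"
  shows "inward i \<bullet> p ! k = inward i \<bullet> p ! i \<longleftrightarrow> k = i \<or> k = nxt i"
  using inward_pos [OF assms] inward_ends [of i] by (cases "k = i \<or> k = nxt i") auto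

lemma inward_hull:
  assumes "i < length p" "x \<in> convex hull set p"
  shows "inward i \<bullet> p ! i \<le> inward i \<bullet> x"
proof -
  have "convex hull set p \<subseteq> {x. inward i \<bullet> p ! i \<le> inward i \<bullet> x}"
    by (rule hull_minimal)
       (use assms inward_nonneg in \<open>auto simp: in_set_conv_nth convex_halfspace_ge\<close>)
  with assms show ?thesis by blast
qed

text \<open>The line of a side supports the hull, and strictness in \<open>ccw\<close> leaves only
  the two ends of the side as generators of the face.\<close>

lemma hull_Int_inward:
  assumes "i < length p"
  shows "convex hull set p \<inter> {x. inward i \<bullet> x = inward i \<bullet> p ! i} = side p i"
proof -
  have "set p \<inter> {x. inward i \<bullet> x = inward i \<bullet> p ! i} = {p ! i, p ! nxt i}"
    using assms inward_ends nth_mem [OF nxt_less] by (auto simp: in_set_conv_nth inward_eq_iff)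
  moreover have "convex hull set p \<inter> {x. inward i \<bullet> x = inward i \<bullet> p ! i} =
      convex hull (set p \<inter> {x. inward i \<bullet> x = inward i \<bullet> p ! i})"
    by (rule convex_hull_Int_supporting_hyperplane)
       (use assms inward_nonneg in \<open>auto simp: in_set_conv_nth\<close>)
  ultimately show ?thesis
    by (simp add: side_def segment_convex_hull)
qed

text \<open>The functional of side \<open>j\<close> vanishes at \<open>x\<close> and is nonnegative
  at both ends of side \<open>i\<close>, so each end that enters \<open>x\<close> with positive
  weight is an end of side \<open>j\<close>.\<close>

lemma side_Int_side:
  assumes i: "i < length p" and j: "j < length p" and "i \<noteq> j"
  shows "side p i \<inter> side p j = side_ends p i \<inter> side_ends p j"
proof
  show "side_ends p i \<inter> side_ends p j \<subseteq> side p i \<inter> side p j"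
    by (auto simp: side_def side_ends_def)
  show "side p i \<inter> side p j \<subseteq> side_ends p i \<inter> side_ends p j"
  proof
    fix x assume x: "x \<in> side p i \<inter> side p j"
    let ?f = "\<lambda>y. inward j \<bullet> y - inward j \<bullet> p ! j"
    have fx: "?f x = 0"
      using x hull_Int_inward [OF j] by auto
    obtain t where t: "0 \<le> t" "t \<le> 1" "x = (1 - t) *\<^sub>R p ! i + t *\<^sub>R p ! nxt i"
      using x by (auto simp: side_def in_segment)
    have "?f x = (1 - t) * ?f (p ! i) + t * ?f (p ! nxt i)"
      by (simp add: t algebra_simps)
    moreover have nonneg: "?f (p ! i) \<ge> 0" "?f (p ! nxt i) \<ge> 0"
      using inward_nonneg [OF j i] inward_nonneg [OF j nxt_less] by simp_all
    ultimately have zero: "(1 - t) * ?f (p ! i) = 0" "t * ?f (p ! nxt i) = 0"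
      using fx t by (smt (verit) mult_nonneg_nonneg)+
    have ends: "?f (p ! k) = 0 \<Longrightarrow> k < length p \<Longrightarrow> p ! k \<in> side_ends p j" for k
      using inward_eq_iff [OF j, of k] by (auto simp: side_ends_def)
    consider "t = 0" | "t = 1" | "?f (p ! i) = 0" "?f (p ! nxt i) = 0"
      using zero by force
    then show "x \<in> side_ends p i \<inter> side_ends p j"
    proof cases
      case 1
      then show ?thesis using zero t ends [OF _ i] by (simp add: side_ends_def [of p i])
    next
      case 2
      then show ?thesis using zero t ends [OF _ nxt_less] by (simp add: side_ends_def [of p i])
    next
      \<comment> \<open>Now both ends of side \<open>i\<close> lie on the line of side
        \<open>j\<close>; with at least three corners this forces \<open>i = j\<close>.\<close>
      case 3
      then have "i = nxt j" "nxt i = j \<or> nxt i = nxt j"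
        using inward_eq_iff [OF j i] inward_eq_iff [OF j nxt_less] \<open>i \<noteq> j\<close> by auto
      then show ?thesis
        using nxt_nxt_neq [OF j] nxt_inject [OF i j] \<open>i \<noteq> j\<close> by metis
    qed
  qed
qed

lemma corner_cross_pos: "i < length p \<Longrightarrow>
  0 < n \<bullet> cross3 (p ! nxt (nxt i) - p ! nxt i) (p ! i - p ! nxt i)"
  using ccw [of "nxt i" i] nxt_less nxt_neq nxt_nxt_neq by metis

lemma not_collinear_corner:
  assumes "i < length p"
  shows "\<not> collinear {p ! i, p ! nxt i, p ! nxt (nxt i)}"
proof
  assume "collinear {p ! i, p ! nxt i, p ! nxt (nxt i)}"
  then have "collinear {p ! nxt (nxt i), p ! nxt i, p ! i}"
    by (simp add: insert_commute)
  then have "collinear {0, p ! nxt (nxt i) - p ! nxt i, p ! i - p ! nxt i}"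
    by (simp add: collinear_3)
  then show False
    using corner_cross_pos [OF assms] by (simp flip: cross_eq_0)
qed

lemma normal_nonzero: "n \<noteq> 0"
  using corner_cross_pos [of 0] nonempty by force

lemma aff_dim: "aff_dim (set p) = 2"
proof -
  have "set p \<subseteq> {x. n \<bullet> x = n \<bullet> p ! 0}"
    using planar by (auto simp: in_set_conv_nth)
  then have "aff_dim (set p) \<le> aff_dim {x. n \<bullet> x = n \<bullet> p ! 0}"
    by (rule aff_dim_subset)
  also have "\<dots> = 2" using normal_nonzero by simp
  finally have "aff_dim (set p) \<le> 2" .
  moreover have "\<not> collinear (set p)"
  proof
    assume *: "collinear (set p)"
    have "0 < length p" using nonempty by simp
    then have "{p ! 0, p ! nxt 0, p ! nxt (nxt 0)} \<subseteq> set p"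
      using nth_mem [OF nxt_less] nth_mem by blast
    then show False
      using * collinear_subset not_collinear_corner [OF \<open>0 < length p\<close>] by blast
  qed
  ultimately show ?thesis
    by (simp add: collinear_aff_dim)
qed

lemma polygon: "polygon p"
  unfolding polygon_def using length_ge_3 distinct aff_dim side_Int_side by blast

lemma compact_hull: "compact (convex hull set p)"
  by (simp add: finite_imp_compact_convex_hull)

text \<open>
  At a corner \<open>v\<close> with neighbours \<open>u\<close> and \<open>w\<close> the hull lies in the cone \<open>v + cone {u - v, w - v}\<close>.
  A functional that supports the hull in a proper face through \<open>v\<close> is therefore constant on at
  most one of the two rays of this cone, and the face lies on that ray.
\<close>

lemma proper_face_in_chain:
  assumes d: "\<And>y. y \<in> convex hull set p \<Longrightarrow> d \<bullet> x \<le> d \<bullet> y"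
    and x: "x \<in> convex hull set p" and z: "z \<in> convex hull set p" "d \<bullet> x < d \<bullet> z"
  shows "x \<in> chain_of p"
proof -
  have "convex hull set p \<inter> {y. d \<bullet> y = d \<bullet> x} = convex hull (set p \<inter> {y. d \<bullet> y = d \<bullet> x})"
    by (rule convex_hull_Int_supporting_hyperplane) (auto intro: d hull_inc)
  then have "set p \<inter> {y. d \<bullet> y = d \<bullet> x} \<noteq> {}"
    using x by fastforce
  then obtain j where j: "j < length p" "d \<bullet> p ! j = d \<bullet> x"
    by (auto simp: in_set_conv_nth)
  then obtain i where i: "i < length p" "nxt i = j"
    using nxt_surj by metis
  define v e g where "v = p ! j" and "e = p ! nxt j - v" and "g = p ! i - v"
  have D: "0 < n \<bullet> cross3 e g"
    using corner_cross_pos [OF i(1)] by (simp add: e_def g_def v_def i)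
  have ortho: "n \<bullet> e = 0" "n \<bullet> g = 0"
    using planar [OF nxt_less [of j]] planar [OF j(1)] planar [OF i(1)]
    by (simp_all add: e_def g_def v_def inner_diff_right)
  \<comment> \<open>Up to the factor \<open>n \<bullet> cross3 e g\<close>, these are the
    coordinates of \<open>y - v\<close> along \<open>e\<close> and \<open>g\<close>. As functionals
    of the two sides at \<open>v\<close>, they are nonnegative on the hull.\<close>
  define \<alpha> \<beta> where "\<alpha> y = inward i \<bullet> y - inward i \<bullet> p ! i"
    and "\<beta> y = inward j \<bullet> y - inward j \<bullet> p ! j" for y
  have cone: "(n \<bullet> cross3 e g) *\<^sub>R (y - v) = \<alpha> y *\<^sub>R e + \<beta> y *\<^sub>R g" if "y \<in> convex hull set p" for y
  proof -
    have "n \<bullet> (y - v) = 0"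
      using planar_convex_hull [OF that] planar [OF j(1)] by (simp add: v_def inner_diff_right)
    moreover have "\<alpha> y = n \<bullet> cross3 (y - v) g"
    proof -
      have "edge_dir i = - g" "y - p ! i = (y - v) - g"
        by (simp_all add: edge_dir_def g_def v_def i)
      then have "\<alpha> y = n \<bullet> cross3 (- g) ((y - v) - g)"
        by (simp only: \<alpha>_def inward_diff)
      also have "cross3 (- g) ((y - v) - g) = cross3 (y - v) g"
        by (simp add: cross3_simps)
      finally show ?thesis .
    qed
    moreover have "\<beta> y = n \<bullet> cross3 e (y - v)"
      unfolding \<beta>_def inward_diff by (simp add: edge_dir_def e_def v_def)
    ultimately show ?thesis
      using planar_decomposition [OF ortho] by simp
  qed
  have dcone: "(n \<bullet> cross3 e g) * (d \<bullet> y - d \<bullet> v) = \<alpha> y * (d \<bullet> e) + \<beta> y * (d \<bullet> g)"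
    if "y \<in> convex hull set p" for y
    using arg_cong [OF cone [OF that], of "inner d"]
    by (simp add: inner_diff_right inner_add_right)
  have de: "0 \<le> d \<bullet> e" "0 \<le> d \<bullet> g"
    using d [OF corner_in_hull [OF nxt_less]] d [OF corner_in_hull [OF i(1)]] j
    by (simp_all add: e_def g_def v_def inner_diff_right)
  have nonneg: "0 \<le> \<alpha> x" "0 \<le> \<beta> x"
    using inward_hull [OF i(1) x] inward_hull [OF j(1) x] by (simp_all add: \<alpha>_def \<beta>_def)
  have "\<alpha> x = 0 \<or> \<beta> x = 0"
  proof (rule ccontr)
    assume "\<not> ?thesis"
    then have "0 < \<alpha> x" "0 < \<beta> x" using nonneg by auto
    moreover have "\<alpha> x * (d \<bullet> e) + \<beta> x * (d \<bullet> g) = 0"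
      using dcone [OF x] j by (simp add: v_def)
    ultimately have "d \<bullet> e = 0" "d \<bullet> g = 0"
      using de by (metis add_nonneg_eq_0_iff less_le mult_eq_0_iff mult_nonneg_nonneg)+
    then show False
      using dcone [OF z(1)] z(2) D j by (simp add: v_def)
  qed
  then have "x \<in> side p i \<or> x \<in> side p j"
    using hull_Int_inward [OF i(1)] hull_Int_inward [OF j(1)] x by (auto simp: \<alpha>_def \<beta>_def)
  then show ?thesis
    using i(1) j(1) by (auto simp: chain_of_def sides_def)
qed

text \<open>A point of the relative frontier has a supporting functional that is strictly larger on
  the relative interior, so it lies in a proper face. Conversely each side is a face, proper because
  it misses a third corner.\<close>

lemma chain_eq_rel_frontier: "chain_of p = rel_frontier (convex hull set p)"
proof
  let ?H = "convex hull set p"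
  have rf: "rel_frontier ?H = ?H - rel_interior ?H"
    by (simp add: rel_frontier_def compact_hull compact_imp_closed)
  have ne: "rel_interior ?H \<noteq> {}"
    by (simp add: rel_interior_eq_empty nonempty)
  show "rel_frontier ?H \<subseteq> chain_of p"
  proof
    fix x assume "x \<in> rel_frontier ?H"
    then have x: "x \<in> ?H" "x \<notin> rel_interior ?H" by (auto simp: rf)
    obtain d where d: "\<And>y. y \<in> ?H \<Longrightarrow> d \<bullet> x \<le> d \<bullet> y"
        "\<And>y. y \<in> rel_interior ?H \<Longrightarrow> d \<bullet> x < d \<bullet> y"
      using supporting_hyperplane_rel_boundary [OF convex_convex_hull x] by metis
    with ne rel_interior_subset show "x \<in> chain_of p"
      using proper_face_in_chain [OF d(1) x(1)] by blast
  qed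
  show "chain_of p \<subseteq> rel_frontier ?H"
  proof
    fix x assume "x \<in> chain_of p"
    then obtain i where i: "i < length p" "x \<in> side p i"
      by (auto simp: chain_of_def sides_def)
    have face: "side p i face_of ?H"
      unfolding hull_Int_inward [OF i(1), symmetric]
      by (rule face_of_Int_supporting_hyperplane_ge) (use inward_hull i in auto)
    have "p ! nxt (nxt i) \<notin> side p i"
      using hull_Int_inward [OF i(1)] inward_eq_iff [OF i(1) nxt_less, of "nxt i"]
        nxt_nxt_neq [OF i(1)] nxt_neq [OF nxt_less] by auto
    then have "side p i \<noteq> ?H"
      using corner_in_hull [OF nxt_less] by metis
    then show "x \<in> rel_frontier ?H"
      using face_of_subset_rel_frontier [OF face] i by blast
  qed
qed

text \<open>The chain is the relative frontier, and the points off it with a bounded component are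
  those of the relative interior.\<close>

lemma region: "region p = convex hull set p"
proof -
  let ?H = "convex hull set p"
  have ri: "rel_interior ?H \<subseteq> affine hull ?H - rel_frontier ?H"
    using rel_interior_subset [of ?H] hull_subset [of ?H affine] by (auto simp: rel_frontier_def)
  have "region p = rel_frontier ?H \<union> rel_interior ?H"
    unfolding region_def chain_eq_rel_frontier
    using bounded_component_iff_rel_interior [OF convex_convex_hull compact_hull] ri
    by auto
  also have "\<dots> = ?H"
    using rel_interior_subset [of ?H]
    by (auto simp: rel_frontier_def compact_hull compact_imp_closed)
  finally show ?thesis .
qed

lemma strictly_convex: "strictly_convex_polygon p"
  unfolding strictly_convex_polygon_def
  using polygon not_collinear_corner by (simp add: region mod_Suc_eq)

lemma side_subset_region: "i < length p \<Longrightarrow> side p i \<subseteq> region p"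
  using hull_Int_inward region by blast

lemma side_Int_rel_interior: "i < length p \<Longrightarrow> side p i \<inter> rel_interior (region p) = {}"
  using chain_eq_rel_frontier
  by (auto simp: region chain_of_def sides_def rel_frontier_def)

end

section \<open>Normals, and polygons in two intersecting planes\<close>

text \<open>Both normals are parallel to the cross product of two consecutive edges, which is
  nonzero by \<open>ccw\<close>.\<close>

lemma ccw_polygons_normals_parallel:
  assumes "ccw_polygon n p" and "ccw_polygon m p"
  shows "cross3 n m = 0"
proof -
  interpret P: ccw_polygon n p by fact
  interpret Q: ccw_polygon m p by fact
  let ?w = "cross3 (P.edge_dir 0) (P.edge_dir (P.nxt 0))"
  have l: "0 < length p" using P.nonempty by simp
  have "0 < n \<bullet> cross3 (p ! P.nxt 0 - p ! 0) (p ! P.nxt (P.nxt 0) - p ! 0)"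
    using P.ccw [OF l P.nxt_less] P.nxt_neq P.nxt_nxt_neq P.nxt_less l by metis
  also have "\<dots> = n \<bullet> ?w"
    by (simp add: P.edge_dir_def cross3_simps)
  finally have "?w \<noteq> 0" by force
  moreover have "Q.edge_dir = P.edge_dir"
    by (simp add: fun_eq_iff P.edge_dir_def Q.edge_dir_def)
  then have "cross3 n ?w = 0" "cross3 m ?w = 0"
    using P.edge_dir_orthogonal [OF l] P.edge_dir_orthogonal [OF P.nxt_less]
      Q.edge_dir_orthogonal [OF l] Q.edge_dir_orthogonal [OF P.nxt_less]
    by (simp_all only: cross_orthogonal_parallel)
  ultimately show ?thesis
    using cross_parallel_trans by blast
qed

text \<open>
  The planes of the two polygons meet in the line that carries the common side, and a convex
  polygon meets the line of one of its sides in that side only.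
\<close>

lemma ccw_polygons_Int:
  assumes "ccw_polygon n p" and "ccw_polygon m q" and "cross3 n m \<noteq> 0"
    and i: "i < length p" and j: "j < length q" and eq: "side p i = side q j"
  shows "region p \<inter> region q = side p i"
proof
  interpret P: ccw_polygon n p by fact
  interpret Q: ccw_polygon m q by fact
  show "side p i \<subseteq> region p \<inter> region q"
    using P.side_subset_region [OF i] Q.side_subset_region [OF j] eq by simp
  show "region p \<inter> region q \<subseteq> side p i"
  proof
    fix x assume x: "x \<in> region p \<inter> region q"
    have in_q: "p ! i \<in> region q" "p ! P.nxt i \<in> region q"
      using Q.side_subset_region [OF j] eq by (metis side_def ends_in_segment subsetD)+
    have n: "n \<bullet> P.edge_dir i = 0" "n \<bullet> (x - p ! i) = 0"
      using x P.planar_convex_hull P.planar [OF i] P.edge_dir_orthogonal [OF i]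
      by (auto simp: P.region inner_diff_right)
    have m: "m \<bullet> P.edge_dir i = 0" "m \<bullet> (x - p ! i) = 0"
      using x in_q Q.planar_convex_hull
      by (auto simp: Q.region inner_diff_right P.edge_dir_def)
    \<comment> \<open>Both normals are parallel to this product; were it nonzero, they would be
      parallel to each other.\<close>
    have "cross3 (P.edge_dir i) (x - p ! i) = 0"
      using cross_parallel_trans [OF cross_orthogonal_parallel cross_orthogonal_parallel, OF n m]
        assms(3) by blast
    then have "P.inward i \<bullet> x = P.inward i \<bullet> p ! i"
      using P.inward_diff [of i x] by simp
    then show "x \<in> side p i"
      using P.hull_Int_inward [OF i] x by (auto simp: P.region)
  qed
qed

section \<open>Complete bipartite contacts\<close>

text \<open>Polygons of one class are disjoint, and polygons of different classes meet in a full
  common side. Sides avoid relative interiors, so the interiors are disjoint as well.\<close>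

lemma complete_bipartite_surface:
  assumes fin: "finite U" "finite V"
    and ccw: "\<And>p. p \<in> U \<union> V \<Longrightarrow> ccw_polygon (N p) p"
    and normals: "\<And>p q. \<lbrakk>p \<in> U; q \<in> V\<rbrakk> \<Longrightarrow> cross3 (N p) (N q) \<noteq> 0"
    and common: "\<And>p q. \<lbrakk>p \<in> U; q \<in> V\<rbrakk> \<Longrightarrow> sides p \<inter> sides q \<noteq> {}"
    and disj: "pairwise (\<lambda>p q. region p \<inter> region q = {}) U"
      "pairwise (\<lambda>p q. region p \<inter> region q = {}) V"
  shows "convex_polyhedral_surface (U \<union> V)"
    and "complete_bipartite_digraph (card U) (card V) (with_proj (adjacency_graph (U \<union> V)))"
proof -
  have contact: "region p \<inter> region q \<in> sides p \<inter> sides q"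
      "rel_interior (region p) \<inter> rel_interior (region q) = {}"
    if p: "p \<in> U" and q: "q \<in> V" for p q
  proof -
    interpret P: ccw_polygon "N p" p using ccw p by blast
    interpret Q: ccw_polygon "N q" q using ccw q by blast
    obtain i j where ij: "i < length p" "j < length q" "side p i = side q j"
      using common [OF p q] by (auto simp: sides_def)
    have eq: "region p \<inter> region q = side p i"
      by (rule ccw_polygons_Int [OF P.ccw_polygon_axioms Q.ccw_polygon_axioms normals [OF p q] ij])
    with ij show "region p \<inter> region q \<in> sides p \<inter> sides q"
      by (auto simp: sides_def)
    show "rel_interior (region p) \<inter> rel_interior (region q) = {}"
      using eq P.side_Int_rel_interior [OF ij(1)] rel_interior_subset by blast
  qed
  \<comment> \<open>A polygon in both classes would have a normal that is not parallel to
    itself.\<close>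
  have UV: "U \<inter> V = {}"
    using ccw ccw_polygons_normals_parallel normals by blast
  have no_common: "sides p \<inter> sides q = {}"
    if p: "ccw_polygon (N p) p" and q: "ccw_polygon (N q) q" and "region p \<inter> region q = {}" for p q
  proof -
    interpret P: ccw_polygon "N p" p by fact
    interpret Q: ccw_polygon "N q" q by fact
    have "side p i \<noteq> side q j" if "i < length p" "j < length q" for i j
    proof -
      have "p ! i \<in> side p i" by (simp add: side_def)
      then show ?thesis
        using P.side_subset_region [OF that(1)] Q.side_subset_region [OF that(2)]
          \<open>region p \<inter> region q = {}\<close> by blast
    qed
    then show ?thesis by (auto simp: sides_def)
  qed
  have cases: "region p \<inter> region q = {} \<and> sides p \<inter> sides q = {} \<or>
      p \<in> U \<and> q \<in> V \<or> p \<in> V \<and> q \<in> U"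
    if "p \<in> U \<union> V" "q \<in> U \<union> V" "p \<noteq> q" for p q
  proof (cases "region p \<inter> region q = {}")
    case True
    then show ?thesis using no_common ccw that by blast
  next
    case False
    then have "\<not> (p \<in> U \<and> q \<in> U)" "\<not> (p \<in> V \<and> q \<in> V)"
      using disj \<open>p \<noteq> q\<close> by (auto dest: pairwiseD)
    then show ?thesis using that by blast
  qed
  show "convex_polyhedral_surface (U \<union> V)"
    unfolding convex_polyhedral_surface_def polyhedral_surface_def
  proof (intro conjI ballI impI)
    show "finite (U \<union> V)" using fin by blast
  next
    fix p assume "p \<in> U \<union> V"
    then interpret P: ccw_polygon "N p" p by (rule ccw)
    show "polygon p" by (rule P.polygon)
    show "strictly_convex_polygon p" by (rule P.strictly_convex)
  next
    fix p q assume pq: "p \<in> U \<union> V" "q \<in> U \<union> V" "p \<noteq> q"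
    show "rel_interior (region p) \<inter> rel_interior (region q) = {}"
      using cases [OF pq] contact(2) [of p q] contact(2) [of q p]
        rel_interior_subset [of "region p"] rel_interior_subset [of "region q"] by blast
    assume "region p \<inter> region q \<noteq> {}"
    then have "p \<in> U \<and> q \<in> V \<or> p \<in> V \<and> q \<in> U"
      using cases [OF pq] by blast
    then have "region p \<inter> region q \<in> sides p \<inter> sides q"
      using contact(1) by (metis Int_commute)
    then show "(\<exists>v \<in> corners p \<inter> corners q. region p \<inter> region q = {v}) \<or>
        region p \<inter> region q \<in> sides p \<inter> sides q" ..
  next
    fix p q r
    assume "p \<in> U \<union> V" "q \<in> U \<union> V" "r \<in> U \<union> V" "p \<noteq> q" "p \<noteq> r" "q \<noteq> r"
      and ne: "region p \<inter> region q \<inter> region r \<noteq> {}"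
    \<comment> \<open>Two of any three polygons belong to the same class and are therefore
      disjoint.\<close>
    with cases [of p q] cases [of p r] cases [of q r] UV have False by blast
    then show "\<exists>v \<in> corners p \<inter> corners q \<inter> corners r. region p \<inter> region q \<inter> region r = {v}" ..
  qed
  have "parcs (adjacency_graph (U \<union> V)) = Sigma U (\<lambda>_. V) \<union> Sigma V (\<lambda>_. U)"
  proof -
    have "(p \<in> U \<union> V \<and> q \<in> U \<union> V \<and> p \<noteq> q \<and> sides p \<inter> sides q \<noteq> {}) \<longleftrightarrow>
        p \<in> U \<and> q \<in> V \<or> p \<in> V \<and> q \<in> U" for p q
      using cases [of p q] common [of p q] common [of q p] UV by (auto simp: Int_commute)
    then show ?thesis
      unfolding adjacency_graph_def by auto
  qed
  then show "complete_bipartite_digraph (card U) (card V) (with_proj (adjacency_graph (U \<union> V)))"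
    unfolding complete_bipartite_digraph_pair_def
    using fin UV by (intro conjI exI [of _ U] exI [of _ V]) (simp_all add: adjacency_graph_def)
qed

text \<open>An injection of the finite vertex set into the naturals transports both classes and all
  arcs; this gives a copy of the graph whose vertices are not polygons.\<close>

lemma complete_bipartite_digraph_relabel:
  fixes G :: "'a pair_pre_digraph"
  assumes K: "complete_bipartite_digraph m k (with_proj G)"
  shows "\<exists>H :: nat pair_pre_digraph.
    complete_bipartite_digraph m k (with_proj H) \<and> digraph_iso (with_proj G) (with_proj H)"
proof -
  obtain U V where UV: "finite (pverts G)" "pverts G = U \<union> V" "U \<inter> V = {}" "card U = m" "card V = k"
      "parcs G = Sigma U (\<lambda>_. V) \<union> Sigma V (\<lambda>_. U)"
    using K unfolding complete_bipartite_digraph_pair_def by blast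
  obtain f :: "'a \<Rightarrow> nat" where f: "inj_on f (pverts G)"
    using finite_imp_inj_to_nat_seg [OF UV(1)] by blast
  define H where "H = \<lparr>pverts = f ` pverts G, parcs = map_prod f f ` parcs G\<rparr>"
  have "map_prod f f ` parcs G = Sigma (f ` U) (\<lambda>_. f ` V) \<union> Sigma (f ` V) (\<lambda>_. f ` U)"
    by (auto simp: UV(6) image_Un map_prod_surj_on)
  moreover have "f ` U \<inter> f ` V = {}" "card (f ` U) = m" "card (f ` V) = k"
    using f UV by (auto simp: inj_on_def card_image inj_on_subset [OF f])
  ultimately have "complete_bipartite_digraph m k (with_proj H)"
    unfolding complete_bipartite_digraph_pair_def
    using UV(1,2) by (intro conjI exI [of _ "f ` U"] exI [of _ "f ` V"]) (simp_all add: H_def image_Un)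
  moreover have "digraph_iso (with_proj G) (with_proj H)"
    unfolding digraph_iso_def
  proof (intro exI conjI)
    let ?h = "\<lparr>iso_verts = f, iso_arcs = map_prod f f, iso_head = snd, iso_tail = fst\<rparr>"
    have "wf_digraph (with_proj G)"
      using UV by (auto simp: wf_digraph_def)
    moreover have "inj_on (map_prod f f) (parcs G)"
      using f UV by (auto simp: inj_on_def)
    ultimately show "pre_digraph.digraph_isomorphism (with_proj G) ?h"
      using f by (simp add: pre_digraph.digraph_isomorphism_def)
    show "with_proj H = app_iso ?h (with_proj G)"
      by (simp add: app_iso_def H_def with_proj_def)
  qed
  ultimately show ?thesis by blast
qed

section \<open>Eight octagons\<close>

definition pt :: "real \<Rightarrow> real \<Rightarrow> real \<Rightarrow> real^3" where
  "pt x y z = vector [x, y, z]"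

lemma pt_eq_iff: "pt x y z = pt x' y' z' \<longleftrightarrow> x = x' \<and> y = y' \<and> z = z'"
  by (simp add: pt_def vec_eq_iff forall_3)

lemma pt_0: "0 = pt 0 0 0"
  by (simp add: pt_def vec_eq_iff forall_3)

lemma pt_diff: "pt x y z - pt x' y' z' = pt (x - x') (y - y') (z - z')"
  by (simp add: pt_def vec_eq_iff forall_3)

lemma pt_inner: "pt x y z \<bullet> pt x' y' z' = x * x' + y * y' + z * z'"
  by (simp add: pt_def inner_vec_def sum_3)

lemma pt_cross: "cross3 (pt x y z) (pt x' y' z') =
    pt (y * z' - z * y') (z * x' - x * z') (x * y' - y * x')"
  by (simp add: pt_def cross3_def)

lemmas pt_simps = pt_eq_iff pt_0 pt_diff pt_inner pt_cross

text \<open>The sides shared with \<open>walls\<close> start at even positions of each list, except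
  in the second floor and the fourth wall, where they start at odd positions.\<close>

definition floors :: "polygon list" where
  "floors =
    [[pt 0 13 18, pt 1 13 18, pt 13 3 18, pt 13 2 18,
      pt 12 (-2) 18, pt 11 (-3) 18, pt (-2) (-5) 18, pt (-3) (-4) 18],
     [pt 2 (-9) (-2), pt 11 13 (-3), pt 12 13 (-8), pt 13 12 (-15),
      pt 13 11 (-17), pt 5 (-9) (-17), pt 4 (-10) (-14), pt 3 (-10) (-9)],
     [pt 0 13 (-18), pt 1 13 (-18), pt 13 1 (-18), pt 13 0 (-18),
      pt 7 (-7) (-18), pt 6 (-8) (-18), pt 0 (-7) (-18), pt (-1) (-6) (-18)],
     [pt (-14) 13 (-1), pt (-13) 13 1, pt 13 1 17, pt 13 0 14,
      pt 12 (-2) 6, pt 11 (-3) 1, pt (-17) 10 (-16), pt (-18) 11 (-15)]]"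

definition walls :: "polygon list" where
  "walls =
    [[pt 13 11 (-17), pt 13 12 (-15), pt 13 3 18, pt 13 2 18,
      pt 13 1 17, pt 13 0 14, pt 13 0 (-18), pt 13 1 (-18)],
     [pt (-14) 13 (-1), pt (-13) 13 1, pt 0 13 18, pt 1 13 18,
      pt 11 13 (-3), pt 12 13 (-8), pt 1 13 (-18), pt 0 13 (-18)],
     [pt (-17) 10 (-16), pt (-18) 11 (-15), pt (-3) (-4) 18, pt (-2) (-5) 18,
      pt 2 (-9) (-2), pt 3 (-10) (-9), pt 0 (-7) (-18), pt (-1) (-6) (-18)],
     [pt 7 (-7) (-18), pt 11 (-3) 1, pt 12 (-2) 6, pt 12 (-2) 18,
      pt 11 (-3) 18, pt 4 (-10) (-14), pt 5 (-9) (-17), pt 6 (-8) (-18)]]"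

section \<open>Verification of convexity and contacts by arithmetic\<close>

text \<open>Index lists replace the quantifiers, so that simplification can evaluate every triple
  product on explicit coordinates.\<close>

lemma ccw_polygon_list_all:
  "ccw_polygon n p \<longleftrightarrow> 3 \<le> length p \<and>
    list_all (\<lambda>k. n \<bullet> p ! k = n \<bullet> p ! 0) [0..<length p] \<and>
    list_all (\<lambda>i. list_all (\<lambda>k. k \<noteq> i \<longrightarrow> k \<noteq> Suc i mod length p \<longrightarrow>
      0 < n \<bullet> cross3 (p ! (Suc i mod length p) - p ! i) (p ! k - p ! i)) [0..<length p]) [0..<length p]"
  unfolding ccw_polygon_def list_all_iff by auto

text \<open>Taken from the first three corners, the normal has the right sign for either direction
  in which a convex polygon is listed.\<close>

definition corner_normal :: "polygon \<Rightarrow> real^3" where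
  "corner_normal p = cross3 (p ! 1 - p ! 0) (p ! 2 - p ! 0)"

lemma ccw_floors_walls: "list_all (\<lambda>p. ccw_polygon (corner_normal p) p) (floors @ walls)"
  by (simp add: floors_def walls_def ccw_polygon_list_all corner_normal_def upt_rec pt_simps)

lemma normals_floors_walls:
  "list_all (\<lambda>p. list_all (\<lambda>q. cross3 (corner_normal p) (corner_normal q) \<noteq> 0) walls) floors"
  by (simp add: floors_def walls_def corner_normal_def pt_simps)

text \<open>A segment is the hull of its ends. Comparing ends as sets ignores the direction in which
  each polygon runs through the side.\<close>

lemma common_sideI:
  assumes "list_ex (\<lambda>i. list_ex (\<lambda>j. side_ends p i = side_ends q j) [0..<length q]) [0..<length p]"
  shows "sides p \<inter> sides q \<noteq> {}"
proof -
  obtain i j where "i < length p" "j < length q" "side_ends p i = side_ends q j"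
    using assms by (auto simp: list_ex_iff)
  moreover have "side r k = convex hull side_ends r k" for r k
    by (simp add: side_def side_ends_def segment_convex_hull)
  ultimately show ?thesis
    by (auto simp: sides_def)
qed

lemma common_sides_floors_walls:
  "list_all (\<lambda>p. list_all (\<lambda>q. list_ex (\<lambda>i. list_ex (\<lambda>j. side_ends p i = side_ends q j)
    [0..<length q]) [0..<length p]) walls) floors"
  by (simp add: floors_def walls_def side_ends_def doubleton_eq_iff upt_rec pt_eq_iff)

section \<open>Strict separation by planes\<close>

definition separated :: "polygon \<Rightarrow> polygon \<Rightarrow> bool" where
  "separated p q \<longleftrightarrow> (\<exists>d c. list_all (\<lambda>x. d \<bullet> x < c) p \<and> list_all (\<lambda>x. c < d \<bullet> x) q)"

lemma separatedI:
  "\<lbrakk>list_all (\<lambda>x. d \<bullet> x < c) p; list_all (\<lambda>x. c < d \<bullet> x) q\<rbrakk> \<Longrightarrow> separated p q"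
  unfolding separated_def by blast

lemma separated_region_disjoint:
  assumes "separated p q" "ccw_polygon n p" "ccw_polygon m q"
  shows "region p \<inter> region q = {}"
  using assms disjoint_convex_hulls [of "set p" _ _ "set q"]
  by (auto simp: separated_def list_all_iff ccw_polygon.region)

text \<open>Disjointness is symmetric, so separating each pair once, in list order,
  suffices.\<close>

lemma pairwise_disjoint_regions:
  assumes sep: "sorted_wrt separated ps" and ccw: "\<And>p. p \<in> set ps \<Longrightarrow> ccw_polygon (N p) p"
  shows "pairwise (\<lambda>p q. region p \<inter> region q = {}) (set ps)"
  using assms
proof (induction ps)
  case (Cons p ps)
  have "region p \<inter> region q = {}" if "q \<in> set ps" for q
    using separated_region_disjoint [of p q "N p" "N q"] Cons.prems that by simp
  moreover have "pairwise (\<lambda>p q. region p \<inter> region q = {}) (set ps)"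
    using Cons by simp
  ultimately show ?case
    by (auto simp: pairwise_insert)
qed simp

lemma separated_floors: "sorted_wrt separated floors"
  unfolding floors_def sorted_wrt.simps list.set ball_simps
  apply (intro conjI TrueI)
       \<comment> \<open>Horizontal planes separate all pairs but the second and fourth floors,
         which overlap in height and need an oblique plane.\<close>
       apply (rule separatedI [of "pt 0 0 (-1)" 0]; simp add: pt_inner)
      apply (rule separatedI [of "pt 0 0 (-1)" 0]; simp add: pt_inner)
     apply (rule separatedI [of "pt 0 0 (-2)" "-35"]; simp add: pt_inner)
    apply (rule separatedI [of "pt 0 0 (-2)" 35]; simp add: pt_inner)
   apply (rule separatedI [of "pt (-32) 16 65" "-337"]; simp add: pt_inner)
  apply (rule separatedI [of "pt 0 0 1" "-17"]; simp add: pt_inner)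
  done

lemma separated_walls: "sorted_wrt separated walls"
  unfolding walls_def sorted_wrt.simps list.set ball_simps
  apply (intro conjI TrueI)
       \<comment> \<open>All six planes are perpendicular to the \<open>x\<close> or the
         \<open>y\<close> axis. The factor 2 yields half-integral positions, here
         \<open>x = 25/2\<close>.\<close>
       apply (rule separatedI [of "pt (-2) 0 0" "-25"]; simp add: pt_inner)
      apply (rule separatedI [of "pt (-1) 0 0" "-8"]; simp add: pt_inner)
     apply (rule separatedI [of "pt 0 (-1) 0" "1"]; simp add: pt_inner)
    apply (rule separatedI [of "pt 0 (-1) 0" "-12"]; simp add: pt_inner)
   apply (rule separatedI [of "pt 0 (-1) 0" "0"]; simp add: pt_inner)
  apply (rule separatedI [of "pt 2 0 0" "7"]; simp add: pt_inner)
  done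

theorem proposition8:
  shows "\<exists>S. convex_polyhedral_surface S \<and>
    (\<exists>K :: nat pair_pre_digraph.
       complete_bipartite_digraph 4 4 (with_proj K) \<and>
       digraph_iso (with_proj (adjacency_graph S)) (with_proj K))"
proof -
  define S where "S = set floors \<union> set walls"
  have ccw: "ccw_polygon (corner_normal p) p" if "p \<in> set floors \<union> set walls" for p
    using ccw_floors_walls that unfolding list_all_iff set_append by blast
  have normals: "cross3 (corner_normal p) (corner_normal q) \<noteq> 0"
    if "p \<in> set floors" "q \<in> set walls" for p q
    using normals_floors_walls that unfolding list_all_iff by blast
  have common: "sides p \<inter> sides q \<noteq> {}" if "p \<in> set floors" "q \<in> set walls" for p q
    using common_sides_floors_walls that unfolding list_all_iff by (intro common_sideI) blast
  have disj: "pairwise (\<lambda>p q. region p \<inter> region q = {}) (set floors)"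
      "pairwise (\<lambda>p q. region p \<inter> region q = {}) (set walls)"
    by (rule pairwise_disjoint_regions [OF separated_floors ccw], simp)
       (rule pairwise_disjoint_regions [OF separated_walls ccw], simp)
  have card: "card (set floors) = 4" "card (set walls) = 4"
    by (simp_all add: floors_def walls_def pt_eq_iff)
  note surface = complete_bipartite_surface
    [where U = "set floors" and V = "set walls" and N = corner_normal,
     OF finite_set finite_set ccw normals common disj, folded S_def, unfolded card]
  from surface(1) complete_bipartite_digraph_relabel [OF surface(2)] show ?thesis
    by blast
qed

end
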